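(* For every $x\in\mathcal M^B$ there exist a radius $r_x>0$ and a $C^2$ map $\delta_x:V_x^B(r_x)\to\mathcal Y$ such that for all $v\in V_x^B(r_x)$, $$R_x\bigl(v-P_xB^*\delta_x(v)\bigr)\in\mathcal M^B,$$ where $V_x^B(r):=\{v\in T_x\mathcal M^B:\|v\|_{\mathcal E}<r\}$.
   Context: $\mathcal E,\mathcal Y$ are real Hilbert spaces. $\mathcal M\subset\mathcal E$ is a $C^2$ embedded submanifold; for $x\in\mathcal M$ the tangent space $T_x\mathcal M$ is identified with a closed linear subspace of $\mathcal E$ with the restricted inner product. $B:\mathcal E\to\mathcal Y$ is a surjective bounded linear operator with adjoint $B^*$, $c\in\mathcal Y$, and $\mathcal M^B:=\{x\in\mathcal M: Bx=c\}$ is nonempty. For each $x\in\mathcal M$ a bounded linear projection $P_x:\mathcal E\to T_x\mathcal M$ onto $T_x\mathcal M$ is given (not necessarily orthogonal). Standing assumption: for every $x\in\mathcal M^B$, $L_x:=BP_xB^*:\mathcal Y\to\mathcal Y$ is invertible. Then $\mathcal M^B$ is a $C^2$ Hilbert submanifold with $T_x\mathcal M^B=T_x\mathcal M\cap\ker B$. For each $x\in\mathcal M$ a $C^2$ map (global retraction) $R_x:T_x\mathcal M\to\mathcal M$ is given with $R_x(0)=x$ and $DR_x(0)=\mathrm{Id}_{T_x\mathcal M}$. *)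

theory Defs
  imports "HOL-Analysis.Analysis"
begin

text \<open>
  Maps on subsets of closed subspaces are encoded by total functions on the ambient space.
  The set \<open>U\<close> is meant to be relatively open in a closed subspace \<open>T\<close> of a Hilbert space
  (possibly \<open>T = UNIV\<close>). The derivatives \<open>f' x\<close> and \<open>f'' x\<close> take arguments in the ambient
  space, but only their restrictions to \<open>T\<close> are determined. Restricting to \<open>T\<close>, and conversely
  composing with the orthogonal projection onto \<open>T\<close>, shows that this is the usual notion of a
  \<open>C\<^sup>2\<close> map on the open subset \<open>U\<close> of the Hilbert space \<open>T\<close>.
\<close>

definition C2_map_on :: "'a::real_normed_vector set \<Rightarrow> ('a \<Rightarrow> 'b::real_normed_vector) \<Rightarrow> bool" where
  "C2_map_on U f \<longleftrightarrow>
     (\<exists>(f' :: 'a \<Rightarrow> 'a \<Rightarrow>\<^sub>L 'b) (f'' :: 'a \<Rightarrow> 'a \<Rightarrow>\<^sub>L ('a \<Rightarrow>\<^sub>L 'b)).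
        (\<forall>x\<in>U. (f has_derivative blinfun_apply (f' x)) (at x within U)) \<and>
        (\<forall>x\<in>U. (f' has_derivative blinfun_apply (f'' x)) (at x within U)) \<and>
        continuous_on U f'')"

text \<open>
  Slice charts. In a Hilbert space every closed subspace is complemented, so no splitting
  condition on \<open>F\<close> is needed. The model space \<open>F\<close> may depend on the point.
\<close>

definition C2_embedded_submanifold :: "'a::{real_inner, complete_space} set \<Rightarrow> bool" where
  "C2_embedded_submanifold M \<longleftrightarrow>
     (\<forall>x\<in>M. \<exists>(U :: 'a set) (V :: 'a set) F (\<phi> :: 'a \<Rightarrow> 'a) (\<psi> :: 'a \<Rightarrow> 'a).
        open U \<and> x \<in> U \<and> open V \<and> subspace F \<and> closed F \<and>
        homeomorphism U V \<phi> \<psi> \<and> C2_map_on U \<phi> \<and> C2_map_on V \<psi> \<and>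
        \<phi> ` (U \<inter> M) = V \<inter> F)"

definition tangent_space :: "'a::real_normed_vector set \<Rightarrow> 'a \<Rightarrow> 'a set" where
  "tangent_space M x =
     {v. \<exists>\<gamma> e. e > 0 \<and> \<gamma> C1_differentiable_on {-e<..<e} \<and> \<gamma> ` {-e<..<e} \<subseteq> M \<and>
            \<gamma> 0 = x \<and> (\<gamma> has_vector_derivative v) (at 0)}"

definition tangent_ball :: "'a::real_normed_vector set \<Rightarrow> 'a \<Rightarrow> real \<Rightarrow> 'a set" where
  "tangent_ball M x r = {v \<in> tangent_space M x. norm v < r}"

definition constraint_set :: "'a set \<Rightarrow> ('a \<Rightarrow> 'b) \<Rightarrow> 'b \<Rightarrow> 'a set" where
  "constraint_set M B c = {x \<in> M. B x = c}"

definition bounded_projection_onto :: "('a::real_normed_vector \<Rightarrow> 'a) \<Rightarrow> 'a set \<Rightarrow> bool" where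
  "bounded_projection_onto p T \<longleftrightarrow> bounded_linear p \<and> range p = T \<and> (\<forall>v. p (p v) = p v)"

text \<open>Invertibility in the algebra of bounded operators.\<close>

definition invertible_operator :: "('a::real_normed_vector \<Rightarrow> 'a) \<Rightarrow> bool" where
  "invertible_operator L \<longleftrightarrow>
     bounded_linear L \<and> (\<exists>G. bounded_linear G \<and> G \<circ> L = id \<and> L \<circ> G = id)"

text \<open>
  The retraction \<open>\<rho>\<close> is only relevant on \<open>tangent_space M x\<close>. For an embedded submanifold, a map
  into \<open>M\<close> is \<open>C\<^sup>2\<close> iff it is \<open>C\<^sup>2\<close> as a map into the ambient space.
\<close>

definition C2_retraction_at ::
    "'a::real_normed_vector set \<Rightarrow> 'a \<Rightarrow> ('a \<Rightarrow> 'a) \<Rightarrow> bool" where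
  "C2_retraction_at M x \<rho> \<longleftrightarrow>
     C2_map_on (tangent_space M x) \<rho> \<and> \<rho> ` tangent_space M x \<subseteq> M \<and> \<rho> 0 = x \<and>
     (\<rho> has_derivative (\<lambda>v. v)) (at 0 within tangent_space M x)"

end

theory Submission imports Defs begin

text \<open>
  Fix \<open>x\<close> in the constraint set, put \<open>T = tangent_space M x\<close>, and let \<open>G\<close> be the inverse of
  \<open>B \<circ> P x \<circ> adjoint B\<close>. The map \<open>F v = G (B (R x (P x v)))\<close> is defined and \<open>C\<^sup>2\<close> on the whole
  ambient space: the projection onto \<open>T\<close> removes the subspace from the problem. Since the
  retraction has the identity as its derivative at \<open>0\<close>, the derivative of \<open>F\<close> at \<open>0\<close> is
  \<open>G \<circ> B \<circ> P x\<close>, and \<open>Q = P x \<circ> adjoint B\<close> is a bounded right inverse of it. Therefore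
  \<open>w \<mapsto> F (v - Q w)\<close> has a derivative close to \<open>- id\<close> near the origin, and the implicit function
  theorem yields a \<open>C\<^sup>2\<close> map \<open>\<delta>\<close> on a ball with \<open>F (v - Q (\<delta> v)) = F 0 = G c\<close>
  (\<open>C2_solution_along_complement\<close>). A tangent vector \<open>v\<close> of the constraint set lies in \<open>T\<close>, and so
  does \<open>v - Q (\<delta> v)\<close>; there \<open>P x\<close> acts as the identity, and injectivity of \<open>G\<close> turns the equation
  into \<open>B (R x (v - Q (\<delta> v))) = c\<close>.

  The implicit function theorem is proved directly. A contraction gives \<open>\<delta>\<close> together with a
  Lipschitz bound (\<open>Lipschitz_solution_along_complement\<close>). Write \<open>D v\<close> for the derivative of \<open>F\<close> at
  \<open>v - Q (\<delta> v)\<close> and \<open>J v\<close> for the inverse of \<open>D v \<circ> Q\<close>, which exists because that operator is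
  within \<open>1/2\<close> of the identity (\<open>near_identity_invertible\<close>). The Lipschitz bound makes the
  linearization error of \<open>F\<close> along the solution \<open>o(h)\<close>, so the derivative of \<open>\<delta>\<close> is \<open>J v \<circ> D v\<close>
  (\<open>implicit_solution_has_derivative\<close>); an exact identity for the increments of this operator
  gives the second derivative (\<open>implicit_derivative_has_derivative\<close>).

  That \<open>Q\<close> is bounded and linear rests on the boundedness of the adjoint, hence on the Riesz
  representation theorem.
\<close>

section \<open>Adjoints of bounded operators between Hilbert spaces\<close>

text \<open>
  The representer minimizes \<open>(norm x)\<^sup>2 - 2 * f x\<close>, which is \<open>(norm (x - a))\<^sup>2\<close> up to a constant.
  The parallelogram law makes every minimizing sequence Cauchy, and a nonzero value of
  \<open>f x - x \<bullet> a\<close> would allow a step from \<open>a\<close> along \<open>x\<close> that decreases the functional further.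
\<close>

lemma Riesz_representation:
  fixes f :: "'a::{real_inner, complete_space} \<Rightarrow> real"
  assumes "bounded_linear f"
  shows "\<exists>a. \<forall>x. f x = x \<bullet> a"
proof -
  interpret f: bounded_linear f by fact
  define q where "q x = (norm x)\<^sup>2 - 2 * f x" for x
  obtain K where K: "\<And>x. norm (f x) \<le> norm x * K"
    using f.bounded by blast
  have q_lower: "- K\<^sup>2 \<le> q x" for x
  proof -
    have "0 \<le> (norm x - K)\<^sup>2" by simp
    then show ?thesis
      using K[of x] by (simp add: q_def power2_diff algebra_simps)
  qed
  define m where "m = Inf (range q)"
  have bdd: "bdd_below (range q)"
    using q_lower by (auto intro!: bdd_belowI[where m = "- K\<^sup>2"])
  have m_le: "m \<le> q x" for x
    unfolding m_def using bdd by (simp add: cINF_lower)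
  have "\<exists>x. q x < m + 1 / real (Suc n)" for n
  proof -
    have "Inf (range q) < m + 1 / real (Suc n)"
      unfolding m_def by simp
    then show ?thesis
      using cInf_lessD[of "range q"] by blast
  qed
  then obtain s where s: "\<And>n. q (s n) < m + 1 / real (Suc n)"
    by metis
  have parallelogram: "(norm (x - y))\<^sup>2 \<le> 2 * (q x - m) + 2 * (q y - m)" for x y
  proof -
    have "q x + q y - 2 * q ((1/2) *\<^sub>R (x + y)) = (norm (x - y))\<^sup>2 / 2"
      unfolding q_def f.scaleR f.add power2_norm_eq_inner
      by (simp add: inner_simps inner_commute field_simps)
    then show ?thesis
      using m_le[of "(1/2) *\<^sub>R (x + y)"] by simp
  qed
  have "Cauchy s"
  proof (rule metric_CauchyI)
    fix e :: real
    assume "0 < e"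
    then obtain N where N: "4 / e\<^sup>2 < real N"
      using reals_Archimedean2 by blast
    have "dist (s i) (s j) < e" if "N \<le> i" "N \<le> j" for i j
    proof -
      have near_inf: "q (s k) < m + e\<^sup>2 / 4" if "N \<le> k" for k
      proof -
        have "4 / e\<^sup>2 < real (Suc k)" using N that by linarith
        then have "1 / real (Suc k) < e\<^sup>2 / 4"
          using \<open>0 < e\<close> by (simp add: field_simps)
        then show ?thesis using s[of k] by simp
      qed
      have "(norm (s i - s j))\<^sup>2 < e\<^sup>2"
      proof -
        have "a < d" if "a \<le> 2 * (b - m) + 2 * (c - m)" "b < m + d / 4" "c < m + d / 4" for a b c d
          using that by (simp add: field_simps)
        then show ?thesis
          using parallelogram near_inf[OF that(1)] near_inf[OF that(2)] by blast
      qed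
      then show ?thesis
        using \<open>0 < e\<close> by (simp add: dist_norm power2_less_imp_less)
    qed
    then show "\<exists>N. \<forall>i\<ge>N. \<forall>j\<ge>N. dist (s i) (s j) < e" by blast
  qed
  then obtain a where a: "s \<longlonglongrightarrow> a"
    using Cauchy_convergent_iff convergent_def by blast
  have "(\<lambda>n. q (s n)) \<longlonglongrightarrow> q a"
    unfolding q_def by (intro tendsto_intros a f.tendsto)
  moreover have "(\<lambda>n. m + 1 / real (Suc n)) \<longlonglongrightarrow> m + 0"
    by (intro tendsto_intros LIMSEQ_Suc[OF lim_1_over_n])
  ultimately have "q a \<le> m + 0"
    using s by (intro LIMSEQ_le) (auto intro: less_imp_le)
  then have min: "q a \<le> q x" for x
    using m_le[of x] by simp
  have "f x = x \<bullet> a" for x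
  proof (rule ccontr)
    assume "f x \<noteq> x \<bullet> a"
    define b where "b = f x - x \<bullet> a"
    have "b \<noteq> 0" using \<open>f x \<noteq> x \<bullet> a\<close> by (simp add: b_def)
    then have "x \<noteq> 0" by (auto simp: b_def f.zero)
    \<comment> \<open>The minimizer of the functional on the line through \<open>a\<close> in direction \<open>x\<close>.\<close>
    define t where "t = b / (x \<bullet> x)"
    have "q (a + t *\<^sub>R x) = q a - 2 * t * b + t\<^sup>2 * (x \<bullet> x)"
      unfolding q_def b_def f.add f.scaleR power2_norm_eq_inner
      by (simp add: inner_simps inner_commute algebra_simps power2_eq_square)
    also have "\<dots> = q a - b\<^sup>2 / (x \<bullet> x)"
      using \<open>x \<noteq> 0\<close> by (simp add: t_def power2_eq_square)
    also have "\<dots> < q a"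
      using \<open>b \<noteq> 0\<close> \<open>x \<noteq> 0\<close> by simp
    finally show False using min[of "a + t *\<^sub>R x"] by simp
  qed
  then show ?thesis by blast
qed

text \<open>
  The constant \<open>adjoint\<close> is a choice of an operator with the adjoint identity, so it is meaningful
  only where such an operator exists. Representing the functionals \<open>x \<mapsto> f x \<bullet> y\<close> supplies it on a
  Hilbert space of any dimension. Its bound comes from
  \<open>(norm (g y))\<^sup>2 = f (g y) \<bullet> y\<close> and the Cauchy-Schwarz inequality.
\<close>

lemma adjoint_bounded_linear:
  fixes f :: "'a::{real_inner, complete_space} \<Rightarrow> 'b::real_inner"
  assumes "bounded_linear f"
  shows "bounded_linear (adjoint f)"
proof -
  interpret f: bounded_linear f by fact
  have "\<exists>a. \<forall>x. f x \<bullet> y = x \<bullet> a" for y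
    by (intro Riesz_representation bounded_linear_inner_left_comp assms)
  then obtain g where g: "\<And>x y. f x \<bullet> y = x \<bullet> g y"
    by metis
  have "adjoint f = g"
    using g by (intro adjoint_unique) simp
  moreover have "bounded_linear g"
  proof -
    obtain K where K: "0 \<le> K" "\<And>x. norm (f x) \<le> norm x * K"
      using f.nonneg_bounded by blast
    have "norm (g y) \<le> norm y * K" for y
    proof (cases "g y = 0")
      case True
      then show ?thesis using K(1) by simp
    next
      case False
      have "norm (g y) * norm (g y) = f (g y) \<bullet> y"
        by (simp add: g flip: power2_norm_eq_inner power2_eq_square)
      also have "\<dots> \<le> norm (f (g y)) * norm y" by (rule norm_cauchy_schwarz)
      also have "\<dots> \<le> norm (g y) * K * norm y" by (intro mult_right_mono K(2)) simp
      finally have "norm (g y) * norm (g y) \<le> norm (g y) * (norm y * K)"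
        by (simp add: ac_simps)
      then show ?thesis using False by simp
    qed
    moreover have "g (x + y) = g x + g y" for x y
      by (subst vector_eq_ldot[symmetric]) (simp add: inner_add_right flip: g)
    moreover have "g (r *\<^sub>R x) = r *\<^sub>R g x" for r x
      by (subst vector_eq_ldot[symmetric]) (simp flip: g)
    ultimately show ?thesis by (intro bounded_linear_intro) auto
  qed
  ultimately show ?thesis by simp
qed

section \<open>Maps of class C2\<close>

interpretation compose: bounded_bilinear blinfun_compose
  by (rule bounded_bilinear_blinfun_compose)

lemma blinfun_compose_assoc: "f o\<^sub>L g o\<^sub>L h = f o\<^sub>L (g o\<^sub>L h)"
  by (rule blinfun_eqI) simp

lemma C2_map_on_subset:
  fixes f :: "'a::real_normed_vector \<Rightarrow> 'b::real_normed_vector"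
  assumes "C2_map_on U f" "V \<subseteq> U"
  shows "C2_map_on V f"
proof -
  obtain f' :: "'a \<Rightarrow> 'a \<Rightarrow>\<^sub>L 'b" and f'' :: "'a \<Rightarrow> 'a \<Rightarrow>\<^sub>L ('a \<Rightarrow>\<^sub>L 'b)" where
    "\<forall>x\<in>U. (f has_derivative f' x) (at x within U)"
    "\<forall>x\<in>U. (f' has_derivative f'' x) (at x within U)"
    "continuous_on U f''"
    using assms(1) unfolding C2_map_on_def by blast
  then show ?thesis
    unfolding C2_map_on_def using assms(2)
    by (intro exI[of _ f'] exI[of _ f''])
      (auto intro: has_derivative_subset continuous_on_subset)
qed

text \<open>
  With \<open>S\<close> a projection onto a subspace \<open>U\<close>, this extends a \<open>C\<^sup>2\<close> map from \<open>U\<close> to the whole space.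
  The derivative of the composite at \<open>x\<close> is \<open>L (f' (S x))\<close>, where \<open>L\<close> is the bounded linear
  operator \<open>X \<mapsto> A \<circ> X \<circ> S\<close>; the second derivative follows by applying the chain rule to this.
\<close>

lemma C2_map_on_compose_linear:
  fixes A :: "'b::real_normed_vector \<Rightarrow> 'c::real_normed_vector"
    and S :: "'d::real_normed_vector \<Rightarrow> 'a::real_normed_vector"
  assumes f: "C2_map_on U f" and A: "bounded_linear A" and S: "bounded_linear S"
    and V: "S ` V \<subseteq> U"
  shows "C2_map_on V (\<lambda>x. A (f (S x)))"
proof -
  obtain f' :: "'a \<Rightarrow> 'a \<Rightarrow>\<^sub>L 'b" and f'' :: "'a \<Rightarrow> 'a \<Rightarrow>\<^sub>L ('a \<Rightarrow>\<^sub>L 'b)" where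
    f': "\<And>x. x \<in> U \<Longrightarrow> (f has_derivative f' x) (at x within U)" and
    f'': "\<And>x. x \<in> U \<Longrightarrow> (f' has_derivative f'' x) (at x within U)" and
    cont: "continuous_on U f''"
    using f unfolding C2_map_on_def by blast
  define a where "a = Blinfun A"
  define s where "s = Blinfun S"
  have a: "A = blinfun_apply a" and s: "S = blinfun_apply s"
    by (simp_all add: a_def s_def A S bounded_linear_Blinfun_apply)
  define L where "L = compose.prod_right a o\<^sub>L compose.prod_left s"
  have L: "L X = a o\<^sub>L (X o\<^sub>L s)" for X
    by (simp add: L_def)
  have lin: "(S has_derivative S) (at x within V)" for x
    by (rule bounded_linear_imp_has_derivative[OF S])
  define g' where "g' x = L (f' (S x))" for x
  define g'' where "g'' x = L o\<^sub>L (f'' (S x) o\<^sub>L s)" for x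
  have "((\<lambda>x. A (f (S x))) has_derivative g' x) (at x within V)" if "x \<in> V" for x
  proof -
    have "((\<lambda>x. A (f (S x))) has_derivative (\<lambda>h. A (f' (S x) (S h)))) (at x within V)"
      using V that
      by (intro bounded_linear.has_derivative[OF A] has_derivative_in_compose2[OF f'] lin) auto
    then show ?thesis
      by (rule has_derivative_eq_rhs) (simp add: fun_eq_iff g'_def L a s)
  qed
  moreover have "(g' has_derivative g'' x) (at x within V)" if "x \<in> V" for x
  proof -
    have "(g' has_derivative (\<lambda>h. L (f'' (S x) (S h)))) (at x within V)"
      unfolding g'_def using V that
      by (intro bounded_linear.has_derivative[OF blinfun.bounded_linear_right]
          has_derivative_in_compose2[OF f''] lin) auto
    then show ?thesis
      by (rule has_derivative_eq_rhs) (simp add: fun_eq_iff g''_def s)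
  qed
  moreover have "continuous_on V g''"
  proof -
    have "continuous_on V (\<lambda>x. f'' (S x))"
      using V by (intro continuous_on_compose2[OF cont] linear_continuous_on S)
    then show ?thesis
      unfolding g''_def
      by (intro compose.continuous_on
          continuous_on_const)
  qed
  ultimately show ?thesis unfolding C2_map_on_def by blast
qed

section \<open>Operators near the identity\<close>

text \<open>
  Instead of summing a Neumann series, surjectivity comes from the contraction
  \<open>x \<mapsto> x - A x + y\<close>, whose fixed point solves \<open>A x = y\<close>; the lower bound
  \<open>norm x \<le> 2 * norm (A x)\<close> gives injectivity and the bound for the inverse.
\<close>

lemma near_identity_invertible:
  fixes A :: "'a::{real_normed_vector, complete_space} \<Rightarrow>\<^sub>L 'a"
  assumes A: "norm (id_blinfun - A) \<le> 1/2"
  shows "\<exists>J. J o\<^sub>L A = id_blinfun \<and> A o\<^sub>L J = id_blinfun \<and> norm J \<le> 2"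
proof -
  have near: "norm (x - A x) \<le> norm x / 2" for x
  proof -
    have "norm (x - A x) = norm ((id_blinfun - A) x)"
      by (simp add: blinfun.diff_left)
    also have "\<dots> \<le> norm (id_blinfun - A) * norm x" by (rule norm_blinfun)
    also have "\<dots> \<le> 1/2 * norm x" by (intro mult_right_mono A) simp
    finally show ?thesis by simp
  qed
  have below: "norm x \<le> 2 * norm (A x)" for x
    using near[of x] norm_triangle_ineq2[of x "A x"] by linarith
  have "\<exists>x. A x = y" for y
  proof -
    have "\<exists>!x. x - A x + y = x"
    proof (rule banach_fix_type[of "1/2"])
      show "\<forall>x x'. dist (x - A x + y) (x' - A x' + y) \<le> 1/2 * dist x x'"
      proof (intro allI)
        fix x x'
        have "(x - A x + y) - (x' - A x' + y) = (x - x') - A (x - x')"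
          by (simp add: blinfun.diff_right)
        then have "dist (x - A x + y) (x' - A x' + y) = norm ((x - x') - A (x - x'))"
          by (simp only: dist_norm)
        then show "dist (x - A x + y) (x' - A x' + y) \<le> 1/2 * dist x x'"
          using near[of "x - x'"] by (simp only: dist_norm)
      qed
    qed auto
    then obtain x where "x - A x + y = x" by blast
    then have "A x = y" by (simp add: algebra_simps)
    then show ?thesis by blast
  qed
  then obtain j where j: "\<And>y. A (j y) = y" by metis
  have inj: "x = x'" if "A x = A x'" for x x'
    using below[of "x - x'"] that by (simp add: blinfun.diff_right)
  have "bounded_linear j"
  proof (rule bounded_linear_intro)
    show "j (x + y) = j x + j y" for x y by (rule inj) (simp add: blinfun.add_right j)
    show "j (r *\<^sub>R x) = r *\<^sub>R j x" for r x by (rule inj) (simp add: blinfun.scaleR_right j)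
    show "norm (j x) \<le> norm x * 2" for x using below[of "j x"] by (simp add: j)
  qed
  then have J: "Blinfun j y = j y" for y by (simp add: bounded_linear_Blinfun_apply)
  have jA: "j (A x) = x" for x by (rule inj) (rule j)
  have "Blinfun j o\<^sub>L A = id_blinfun" "A o\<^sub>L Blinfun j = id_blinfun"
    by (rule blinfun_eqI, simp add: J j jA)+
  moreover have "norm (Blinfun j) \<le> 2"
  proof (rule norm_blinfun_bound)
    show "norm (Blinfun j y) \<le> 2 * norm y" for y using below[of "j y"] by (simp add: J j)
  qed simp
  ultimately show ?thesis by blast
qed

section \<open>Solving a nonlinear equation along a complement\<close>

text \<open>
  The mean value inequality for \<open>F - F' 0\<close> on the ball of radius \<open>s\<close>.
\<close>

lemma linearization_error_Lipschitz:
  fixes F :: "'a::real_normed_vector \<Rightarrow> 'b::real_normed_vector"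
  assumes F': "\<And>z. (F has_derivative blinfun_apply (F' z)) (at z)"
    and near: "\<And>z. norm z < s \<Longrightarrow> norm (F' z - F' 0) \<le> \<epsilon>"
    and x: "norm x < s" and y: "norm y < s"
  shows "norm (F x - F y - F' 0 (x - y)) \<le> \<epsilon> * norm (x - y)"
proof -
  have "norm ((F x - F' 0 x) - (F y - F' 0 y)) \<le> \<epsilon> * norm (x - y)"
  proof (rule differentiable_bound[where S = "ball 0 s"])
    show "((\<lambda>z. F z - F' 0 z) has_derivative blinfun_apply (F' z - F' 0)) (at z within ball 0 s)"
      for z
      by (auto intro!: derivative_eq_intros has_derivative_at_withinI[OF F']
          simp: blinfun.diff_left)
    show "onorm (blinfun_apply (F' z - F' 0)) \<le> \<epsilon>" if "z \<in> ball 0 s" for z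
      using near[of z] that by (simp flip: norm_blinfun.rep_eq)
  qed (use x y in auto)
  then show ?thesis by (simp add: blinfun.diff_right algebra_simps)
qed

text \<open>
  For fixed \<open>v\<close> the equation \<open>F (v - Q w) = F 0\<close> is the fixed point equation of
  \<open>K v w = w + F (v - Q w) - F 0\<close>. As \<open>F' 0 \<circ> Q\<close> is the identity, the linear parts in \<open>w\<close> cancel,
  and what remains of the \<open>w\<close>-dependence is the linearization error of \<open>F\<close>, with constant
  \<open>\<epsilon> * norm Q \<le> 1/2\<close>. Thus \<open>K v\<close> is a contraction, and its Lipschitz dependence on \<open>v\<close> is
  inherited by the fixed point with twice the constant.
\<close>

lemma Lipschitz_solution_along_complement:
  fixes F :: "'a::real_normed_vector \<Rightarrow> 'b::{real_normed_vector, complete_space}"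
    and Q :: "'b \<Rightarrow>\<^sub>L 'a"
  assumes F': "\<And>z. (F has_derivative blinfun_apply (F' z)) (at z)"
    and Q: "F' 0 o\<^sub>L Q = id_blinfun"
    and s: "0 < s" and near: "\<And>z. norm z < s \<Longrightarrow> norm (F' z - F' 0) \<le> \<epsilon>"
    and \<epsilon>: "\<epsilon> * norm Q \<le> 1/2"
  shows "\<exists>r>0. \<exists>\<delta> C. (\<forall>v\<in>ball 0 r. norm (v - Q (\<delta> v)) < s \<and> F (v - Q (\<delta> v)) = F 0) \<and>
           (\<forall>v\<in>ball 0 r. \<forall>v'\<in>ball 0 r. norm (\<delta> v - \<delta> v') \<le> C * norm (v - v'))"
proof -
  have FQ: "F' 0 (Q w) = w" for w
    using Q by (metis blinfun_apply_blinfun_compose blinfun_apply_id_blinfun)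
  have \<epsilon>0: "0 \<le> \<epsilon>" using near[of 0] s by simp
  define K where "K v w = w + F (v - Q w) - F 0" for v w
  define C where "C = \<epsilon> + norm (F' 0)"
  have C: "0 \<le> C" using \<epsilon>0 by (simp add: C_def)
  \<comment> \<open>The radius \<open>t\<close> for \<open>w\<close> and the radius \<open>r\<close> for \<open>v\<close> each use half of \<open>s\<close>, so \<open>v - Q w\<close> stays in
    the ball of radius \<open>s\<close>; moreover \<open>C * r \<le> t/2\<close> makes \<open>K v\<close> map the \<open>t\<close>-ball into itself.\<close>
  define t where "t = s / 2 / (norm Q + 1)"
  define r where "r = min (s/2) (t / (2 * (C + 1)))"
  have t: "0 < t" using s by (simp add: t_def add_nonneg_pos)
  have r: "0 < r" using s t C by (simp add: r_def)
  have Qt: "norm Q * t \<le> s/2"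
  proof -
    have "norm Q * t \<le> (norm Q + 1) * t" using t by (intro mult_right_mono) auto
    also have "\<dots> = s/2"
      using norm_ge_zero[of Q] by (simp add: t_def add_nonneg_eq_0_iff del: divide_divide_eq_left)
    finally show ?thesis .
  qed
  have Cr: "C * r \<le> t/2"
  proof -
    have "C * r \<le> (C + 1) * (t / (2 * (C + 1)))"
      using C r by (intro mult_mono) (auto simp: r_def)
    also have "\<dots> = t/2" using C by (simp add: field_simps)
    finally show ?thesis .
  qed
  have dom: "norm (v - Q w) < s" if "norm v < r" "norm w \<le> t" for v w
  proof -
    have "norm (v - Q w) \<le> norm v + norm (Q w)" by (rule norm_triangle_ineq4)
    also have "norm (Q w) \<le> norm Q * norm w" by (rule norm_blinfun)
    also have "norm Q * norm w \<le> norm Q * t" by (intro mult_left_mono that) simp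
    finally show ?thesis using Qt that(1) by (simp add: r_def)
  qed
  have K: "norm (K v w - K v' w') \<le> norm (w - w') / 2 + C * norm (v - v')"
    if "norm v < r" "norm w \<le> t" "norm v' < r" "norm w' \<le> t" for v w v' w'
  proof -
    define x where "x = v - Q w"
    define y where "y = v' - Q w'"
    have diff: "x - y = (v - v') - Q (w - w')"
      by (simp add: x_def y_def blinfun.diff_right)
    have "K v w - K v' w' = (F x - F y - F' 0 (x - y)) + F' 0 (v - v')"
      unfolding diff by (simp add: K_def x_def y_def blinfun.diff_right FQ)
    also have "norm \<dots> \<le> norm (F x - F y - F' 0 (x - y)) + norm (F' 0 (v - v'))"
      by (rule norm_triangle_ineq)
    also have "norm (F x - F y - F' 0 (x - y)) \<le> \<epsilon> * norm (x - y)"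
    proof (rule linearization_error_Lipschitz[OF F' near])
      show "norm x < s" "norm y < s"
        unfolding x_def y_def using dom that by blast+
    qed
    also have "norm (x - y) \<le> norm (v - v') + norm Q * norm (w - w')"
      unfolding diff by (rule order_trans[OF norm_triangle_ineq4 add_left_mono[OF norm_blinfun]])
    also have "norm (F' 0 (v - v')) \<le> norm (F' 0) * norm (v - v')"
      by (rule norm_blinfun)
    finally have "norm (K v w - K v' w')
        \<le> \<epsilon> * (norm (v - v') + norm Q * norm (w - w')) + norm (F' 0) * norm (v - v')"
      using \<epsilon>0 by (simp add: mult_left_mono)
    moreover have "\<epsilon> * norm Q * norm (w - w') \<le> 1/2 * norm (w - w')"
      by (intro mult_right_mono \<epsilon>) simp
    ultimately show ?thesis by (simp add: C_def algebra_simps)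
  qed
  have ex1: "\<exists>!w. w \<in> cball 0 t \<and> K v w = w" if v: "v \<in> ball 0 r" for v
  proof (rule Banach_fix[where c = "1/2"])
    show "complete (cball (0::'b) t)" by (simp add: complete_eq_closed)
    show "cball (0::'b) t \<noteq> {}" using t by simp
    show "K v ` cball 0 t \<subseteq> cball 0 t"
    proof (rule image_subsetI)
      fix w :: 'b
      assume "w \<in> cball 0 t"
      then have w: "norm w \<le> t" by simp
      have "norm (K v w - K 0 0) \<le> norm (w - 0) / 2 + C * norm (v - 0)"
        using v w r t by (intro K) auto
      also have "C * norm (v - 0) \<le> C * r" using v C by (intro mult_left_mono) auto
      finally show "K v w \<in> cball 0 t" using Cr w by (simp add: K_def)
    qed
    show "dist (K v w) (K v w') \<le> 1/2 * dist w w'" if "w \<in> cball 0 t" "w' \<in> cball 0 t" for w w'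
      using K[of v w v w'] v that by (simp add: dist_norm)
  qed simp_all
  define \<delta> where "\<delta> v = (THE w. w \<in> cball 0 t \<and> K v w = w)" for v
  have \<delta>: "norm (\<delta> v) \<le> t \<and> K v (\<delta> v) = \<delta> v" if "v \<in> ball 0 r" for v
    using theI'[OF ex1[OF that]] by (simp add: \<delta>_def)
  have "norm (v - Q (\<delta> v)) < s \<and> F (v - Q (\<delta> v)) = F 0" if "v \<in> ball 0 r" for v
    using \<delta>[OF that] dom[of v "\<delta> v"] that by (simp add: K_def algebra_simps)
  moreover have "norm (\<delta> v - \<delta> v') \<le> (2 * C) * norm (v - v')"
    if "v \<in> ball 0 r" "v' \<in> ball 0 r" for v v'
    using K[of v "\<delta> v" v' "\<delta> v'"] \<delta>[OF that(1)] \<delta>[OF that(2)] that by simp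
  ultimately show ?thesis
    using r by (intro exI[of _ r] exI[of _ \<delta>] exI[of _ "2 * C"] conjI ballI) auto
qed

text \<open>
  For the increments \<open>h = y - x\<close> and \<open>k = \<delta> y - \<delta> x\<close> put \<open>p = h - Q k\<close>. Then
  \<open>k - J (D h) = - J (D p)\<close>, and \<open>D p\<close> is minus the linearization error of \<open>F\<close> because \<open>F\<close> takes
  the same value at both ends. The Lipschitz bound on \<open>\<delta>\<close> gives \<open>norm p = O(norm h)\<close>, so this error
  is \<open>o(h)\<close>.
\<close>

lemma implicit_solution_has_derivative:
  fixes F :: "'a::real_normed_vector \<Rightarrow> 'b::real_normed_vector"
    and Q :: "'b \<Rightarrow>\<^sub>L 'a" and J :: "'b \<Rightarrow>\<^sub>L 'b"
  assumes F': "(F has_derivative blinfun_apply D) (at (x - Q (\<delta> x)))"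
    and J: "J o\<^sub>L D o\<^sub>L Q = id_blinfun"
    and Lip: "\<And>y. y \<in> U \<Longrightarrow> norm (\<delta> y - \<delta> x) \<le> C * norm (y - x)"
    and level: "\<And>y. y \<in> U \<Longrightarrow> F (y - Q (\<delta> y)) = F (x - Q (\<delta> x))"
  shows "(\<delta> has_derivative blinfun_apply (J o\<^sub>L D)) (at x within U)"
  unfolding has_derivative_within_alt
proof (intro conjI allI impI)
  show "bounded_linear (blinfun_apply (J o\<^sub>L D))" by (rule blinfun.bounded_linear_right)
next
  fix e :: real
  assume e: "0 < e"
  define N where "N = 1 + norm Q * \<bar>C\<bar>"
  have N: "0 < N" by (simp add: N_def add_pos_nonneg)
  define e' where "e' = e / ((norm J + 1) * N)"
  have e': "0 < e'" using e N by (simp add: e'_def add_nonneg_pos)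
  have e'_le: "norm J * (e' * N) \<le> e"
  proof -
    have "norm J * (e' * N) \<le> (norm J + 1) * (e' * N)"
      using e' N by (intro mult_right_mono) auto
    also have "\<dots> = e"
      using N norm_ge_zero[of J] by (simp add: e'_def add_nonneg_eq_0_iff)
    finally show ?thesis .
  qed
  obtain d where d: "0 < d" and
    dd: "\<And>z. norm (z - (x - Q (\<delta> x))) < d \<Longrightarrow>
      norm (F z - F (x - Q (\<delta> x)) - D (z - (x - Q (\<delta> x)))) \<le> e' * norm (z - (x - Q (\<delta> x)))"
    using F' e' unfolding has_derivative_within_alt by auto
  have "norm (\<delta> y - \<delta> x - (J o\<^sub>L D) (y - x)) \<le> e * norm (y - x)"
    if y: "y \<in> U" "norm (y - x) < d / N" for y
  proof -
    define p where "p = (y - Q (\<delta> y)) - (x - Q (\<delta> x))"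
    have p_eq: "p = (y - x) - Q (\<delta> y - \<delta> x)"
      by (simp add: p_def blinfun.diff_right)
    have p: "norm p \<le> N * norm (y - x)"
    proof -
      have "norm p \<le> norm (y - x) + norm Q * norm (\<delta> y - \<delta> x)"
        unfolding p_eq
        by (rule order_trans[OF norm_triangle_ineq4 add_left_mono[OF norm_blinfun]])
      also have "norm (\<delta> y - \<delta> x) \<le> \<bar>C\<bar> * norm (y - x)"
        by (rule order_trans[OF Lip[OF y(1)]]) (simp add: mult_right_mono)
      finally show ?thesis by (simp add: N_def distrib_right mult.assoc mult_left_mono)
    qed
    have "norm p < d"
      using p y(2) N by (simp add: field_simps)
    then have small: "norm (D p) \<le> e' * norm p"
      using dd[of "y - Q (\<delta> y)"] level[OF y(1)] by (simp add: p_def)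
    have "J (D (Q w)) = w" for w
      using J by (metis blinfun_apply_blinfun_compose blinfun_apply_id_blinfun)
    then have "\<delta> y - \<delta> x - (J o\<^sub>L D) (y - x) = - J (D p)"
      by (simp add: p_eq blinfun.diff_right)
    then have "norm (\<delta> y - \<delta> x - (J o\<^sub>L D) (y - x)) \<le> norm J * norm (D p)"
      by (simp add: norm_blinfun)
    also have "\<dots> \<le> norm J * (e' * (N * norm (y - x)))"
    proof (rule mult_left_mono)
      show "norm (D p) \<le> e' * (N * norm (y - x))"
        using small mult_left_mono[OF p, of e'] e' by linarith
    qed simp
    also have "\<dots> \<le> e * norm (y - x)"
      using mult_right_mono[OF e'_le, of "norm (y - x)"] by (simp add: mult.assoc)
    finally show ?thesis .
  qed
  then show "\<exists>d>0. \<forall>y\<in>U. norm (y - x) < d \<longrightarrow>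
      norm (\<delta> y - \<delta> x - (J o\<^sub>L D) (y - x)) \<le> e * norm (y - x)"
    using d N by (intro exI[of _ "d / N"]) auto
qed

text \<open>
  A factor that is merely continuous suffices where the other factor vanishes: the product rule
  term containing the derivative of \<open>f\<close> would be multiplied by \<open>g x = 0\<close>.
\<close>

lemma (in bounded_bilinear) has_derivative_prod_vanishing_right:
  assumes f: "continuous (at x within S) f"
    and g: "(g has_derivative g') (at x within S)" and g0: "g x = 0"
  shows "((\<lambda>y. prod (f y) (g y)) has_derivative (\<lambda>h. prod (f x) (g' h))) (at x within S)"
proof -
  have *: "((\<lambda>y. prod (f y - f x) (g y)) has_derivative (\<lambda>h. 0)) (at x within S)"
    unfolding has_derivative_within_alt
  proof (intro conjI allI impI)
    show "bounded_linear (\<lambda>h::'d. 0::'c)" by (rule bounded_linear_zero)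
  next
    fix e :: real
    assume e: "0 < e"
    obtain K where K: "0 < K" "\<And>a b. norm (prod a b) \<le> norm a * norm b * K"
      using pos_bounded by blast
    obtain B where B: "0 < B" "\<And>h. norm (g' h) \<le> norm h * B"
      using bounded_linear.pos_bounded[OF has_derivative_bounded_linear[OF g]] by blast
    obtain d1 where d1: "0 < d1"
      "\<And>y. y \<in> S \<Longrightarrow> norm (y - x) < d1 \<Longrightarrow> norm (g y - g' (y - x)) \<le> norm (y - x)"
      using g g0 unfolding has_derivative_within_alt by (auto dest!: spec[of _ 1])
    define e' where "e' = e / (K * (B + 1))"
    have e': "0 < e'" using e K(1) B(1) by (simp add: e'_def)
    obtain d2 where d2: "0 < d2" "\<And>y. y \<in> S \<Longrightarrow> norm (y - x) < d2 \<Longrightarrow> norm (f y - f x) < e'"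
      using f e' unfolding continuous_within_eps_delta dist_norm by blast
    have "norm (prod (f y - f x) (g y)) \<le> e * norm (y - x)"
      if y: "y \<in> S" "norm (y - x) < min d1 d2" for y
    proof -
      have "norm (g y) \<le> (B + 1) * norm (y - x)"
        using d1(2)[OF y(1)] y(2) B(2)[of "y - x"]
          norm_triangle_ineq[of "g y - g' (y - x)" "g' (y - x)"] by (simp add: algebra_simps)
      then have "norm (f y - f x) * norm (g y) \<le> e' * ((B + 1) * norm (y - x))"
        using d2(2)[OF y(1)] y(2) e' by (intro mult_mono) auto
      then have "norm (f y - f x) * norm (g y) * K \<le> e' * ((B + 1) * norm (y - x)) * K"
        using K(1) by (intro mult_right_mono) auto
      also have "\<dots> = e * norm (y - x)"
      proof -
        have "e' * ((B + 1) * norm (y - x)) * K = (e' * (K * (B + 1))) * norm (y - x)"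
          by (simp only: ac_simps)
        also have "e' * (K * (B + 1)) = e"
        proof -
          have "K * (B + 1) \<noteq> 0" using K(1) B(1) by simp
          then show ?thesis using e'_def by (metis nonzero_eq_divide_eq)
        qed
        finally show ?thesis .
      qed
      finally show ?thesis using K(2) order_trans by blast
    qed
    then show "\<exists>d>0. \<forall>y\<in>S. norm (y - x) < d \<longrightarrow>
        norm (prod (f y - f x) (g y) - prod (f x - f x) (g x) - 0) \<le> e * norm (y - x)"
      using d1(1) d2(1) by (intro exI[of _ "min d1 d2"]) (auto simp: zero_left)
  qed
  have "((\<lambda>y. prod (f y - f x) (g y) + prod (f x) (g y)) has_derivative (\<lambda>h. 0 + prod (f x) (g' h)))
      (at x within S)"
    by (intro has_derivative_add * bounded_linear.has_derivative[OF bounded_linear_right g])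
  then show ?thesis by (simp add: diff_left)
qed

text \<open>
  Continuity of the inverse follows from the resolvent identity
  \<open>J y - J x = J y \<circ> (A x - A y) \<circ> J x\<close> and the uniform bound on \<open>J\<close>.
\<close>

lemma inverse_family_continuous:
  fixes A J :: "'x::metric_space \<Rightarrow> 'a::real_normed_vector \<Rightarrow>\<^sub>L 'a"
  assumes A: "continuous_on U A"
    and inv: "\<And>x. x \<in> U \<Longrightarrow> J x o\<^sub>L A x = id_blinfun" "\<And>x. x \<in> U \<Longrightarrow> A x o\<^sub>L J x = id_blinfun"
    and bound: "\<And>x. x \<in> U \<Longrightarrow> norm (J x) \<le> K"
  shows "continuous_on U J"
  unfolding continuous_on_def
proof
  fix x
  assume x: "x \<in> U"
  have K: "0 \<le> K" using bound[OF x] norm_ge_zero order_trans by blast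
  have resolvent: "norm (J y - J x) \<le> K * norm (A y - A x) * K" if y: "y \<in> U" for y
  proof -
    have "J y - J x = J y o\<^sub>L (A x - A y) o\<^sub>L J x"
    proof (rule blinfun_eqI)
      fix z
      have "A x (J x z) = z" "J y (A y (J x z)) = J x z"
        using inv(2)[OF x] inv(1)[OF y]
        by (metis blinfun_apply_blinfun_compose blinfun_apply_id_blinfun)+
      then show "(J y - J x) z = (J y o\<^sub>L (A x - A y) o\<^sub>L J x) z"
        by (simp add: blinfun.diff_left blinfun.diff_right)
    qed
    also have "norm \<dots> \<le> norm (J y) * norm (A x - A y) * norm (J x)"
      by (meson mult_right_mono norm_blinfun_compose norm_ge_zero order_trans)
    also have "\<dots> \<le> K * norm (A x - A y) * K"
      using K by (intro mult_mono bound x y) auto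
    finally show ?thesis by (simp add: norm_minus_commute)
  qed
  have "((\<lambda>y. K * norm (A y - A x) * K) \<longlongrightarrow> K * norm (A x - A x) * K) (at x within U)"
    using A x unfolding continuous_on_def by (intro tendsto_intros) auto
  then have null: "((\<lambda>y. K * norm (A y - A x) * K) \<longlongrightarrow> 0) (at x within U)" by simp
  have "((\<lambda>y. J y - J x) \<longlongrightarrow> 0) (at x within U)"
    by (rule Lim_null_comparison[OF _ null]) (auto simp: eventually_at_filter resolvent)
  then show "(J \<longlongrightarrow> J x) (at x within U)" by (rule LIM_zero_cancel)
qed

text \<open>
  Put \<open>E = id - Q \<circ> J x \<circ> D x\<close>. Since \<open>J y\<close> is a left inverse of \<open>D y \<circ> Q\<close>, the increment of
  \<open>J \<circ> D\<close> from \<open>x\<close> to \<open>y\<close> is exactly \<open>J y \<circ> D y \<circ> E\<close>, and \<open>D x \<circ> E = 0\<close> since \<open>J x\<close> is also a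
  right inverse. Hence only the factor \<open>D y \<circ> E\<close> has to be differentiated, and continuity of
  \<open>J\<close> is enough.
\<close>

lemma implicit_derivative_has_derivative:
  fixes D :: "'a::real_normed_vector \<Rightarrow> 'a \<Rightarrow>\<^sub>L 'b::real_normed_vector"
    and Q :: "'b \<Rightarrow>\<^sub>L 'a" and J :: "'a \<Rightarrow> 'b \<Rightarrow>\<^sub>L 'b"
  assumes D: "(D has_derivative D') (at x within U)" and x: "x \<in> U"
    and J: "continuous_on U J"
    and inv: "\<And>y. y \<in> U \<Longrightarrow> J y o\<^sub>L (D y o\<^sub>L Q) = id_blinfun"
      "\<And>y. y \<in> U \<Longrightarrow> (D y o\<^sub>L Q) o\<^sub>L J y = id_blinfun"
  shows "((\<lambda>y. J y o\<^sub>L D y) has_derivative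
           (\<lambda>h. J x o\<^sub>L (D' h o\<^sub>L (id_blinfun - (Q o\<^sub>L (J x o\<^sub>L D x)))))) (at x within U)"
proof -
  define E where "E = id_blinfun - (Q o\<^sub>L (J x o\<^sub>L D x))"
  have inv': "J y (D y (Q w)) = w" "D y (Q (J y w)) = w" if "y \<in> U" for y w
    using inv[OF that] by (metis blinfun_apply_blinfun_compose blinfun_apply_id_blinfun)+
  have E0: "D x o\<^sub>L E = 0"
    by (rule blinfun_eqI) (simp add: E_def blinfun.diff_left blinfun.diff_right inv' x)
  have E: "J y o\<^sub>L D y = (J x o\<^sub>L D x) + (J y o\<^sub>L (D y o\<^sub>L E))" if "y \<in> U" for y
    by (rule blinfun_eqI)
      (simp add: E_def blinfun.diff_left blinfun.diff_right blinfun.add_left inv' that)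
  have "((\<lambda>y. D y o\<^sub>L E) has_derivative (\<lambda>h. D' h o\<^sub>L E)) (at x within U)"
    by (rule bounded_linear.has_derivative[OF compose.bounded_linear_left D])
  then have "((\<lambda>y. J y o\<^sub>L (D y o\<^sub>L E)) has_derivative (\<lambda>h. J x o\<^sub>L (D' h o\<^sub>L E))) (at x within U)"
    using J x E0
    by (intro compose.has_derivative_prod_vanishing_right) (auto simp: continuous_on_eq_continuous_within)
  then have "((\<lambda>y. (J x o\<^sub>L D x) + (J y o\<^sub>L (D y o\<^sub>L E))) has_derivative (\<lambda>h. 0 + (J x o\<^sub>L (D' h o\<^sub>L E))))
      (at x within U)"
    by (intro has_derivative_add has_derivative_const)
  then show ?thesis
    unfolding E_def[symmetric] add_0_left
    by (rule has_derivative_transform[OF x E, rotated]) auto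
qed

text \<open>
  This is the implicit function theorem for \<open>(v, w) \<mapsto> F (v - Q w)\<close> at the origin, normalized so
  that the partial derivative in \<open>w\<close> is \<open>- id\<close> there.
\<close>

lemma C2_solution_along_complement:
  fixes F :: "'a::real_normed_vector \<Rightarrow> 'b::{real_normed_vector, complete_space}"
    and Q :: "'b \<Rightarrow> 'a"
  assumes F: "C2_map_on UNIV F" and F0: "(F has_derivative F0) (at 0)"
    and Q: "bounded_linear Q" and F0Q: "\<And>w. F0 (Q w) = w"
  shows "\<exists>r>0. \<exists>\<delta>. C2_map_on (ball 0 r) \<delta> \<and> (\<forall>v\<in>ball 0 r. F (v - Q (\<delta> v)) = F 0)"
proof -
  obtain F' :: "'a \<Rightarrow> 'a \<Rightarrow>\<^sub>L 'b" and F'' :: "'a \<Rightarrow> 'a \<Rightarrow>\<^sub>L ('a \<Rightarrow>\<^sub>L 'b)" where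
    F': "\<And>z. (F has_derivative F' z) (at z)" and
    F'': "\<And>z. (F' has_derivative F'' z) (at z)" and
    cont: "continuous_on UNIV F''"
    using F unfolding C2_map_on_def by auto
  define q where "q = Blinfun Q"
  have q: "Q = blinfun_apply q" by (simp add: q_def Q bounded_linear_Blinfun_apply)
  have F0_eq: "F0 = blinfun_apply (F' 0)" by (rule has_derivative_unique[OF F0 F'])
  then have F'0: "F' 0 o\<^sub>L q = id_blinfun" by (intro blinfun_eqI) (simp add: F0Q flip: q F0_eq)
  \<comment> \<open>This oscillation of the derivative keeps every \<open>D v \<circ> Q\<close> within \<open>1/2\<close> of the identity.\<close>
  define \<epsilon> where "\<epsilon> = 1 / (2 * (norm q + 1))"
  have \<epsilon>: "0 < \<epsilon>" by (simp add: \<epsilon>_def add_nonneg_pos)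
  have \<epsilon>q: "\<epsilon> * norm q \<le> 1/2"
    by (simp add: \<epsilon>_def divide_simps) (smt (verit) norm_ge_zero)
  have "isCont F' 0" using F'' has_derivative_continuous by blast
  then obtain s where s: "0 < s" and near': "\<And>z. norm z < s \<Longrightarrow> norm (F' z - F' 0) < \<epsilon>"
    using \<epsilon> unfolding continuous_at_eps_delta dist_norm by (metis diff_zero)
  then have near: "\<And>z. norm z < s \<Longrightarrow> norm (F' z - F' 0) \<le> \<epsilon>" by (meson less_imp_le)
  obtain r \<delta> C where r: "0 < r"
    and dom: "\<And>v. v \<in> ball 0 r \<Longrightarrow> norm (v - q (\<delta> v)) < s"
    and level: "\<And>v. v \<in> ball 0 r \<Longrightarrow> F (v - q (\<delta> v)) = F 0"
    and Lip: "\<And>v v'. v \<in> ball 0 r \<Longrightarrow> v' \<in> ball 0 r \<Longrightarrow> norm (\<delta> v - \<delta> v') \<le> C * norm (v - v')"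
    using Lipschitz_solution_along_complement[OF F' F'0 s near \<epsilon>q] by blast
  define U where "U = ball (0::'a) r"
  define Z where "Z v = v - q (\<delta> v)" for v
  define D where "D v = F' (Z v)" for v
  have "norm (id_blinfun - (D v o\<^sub>L q)) \<le> 1/2" if "v \<in> U" for v
  proof -
    have "id_blinfun - (D v o\<^sub>L q) = (F' 0 - D v) o\<^sub>L q"
      unfolding F'0[symmetric]
      by (rule compose.diff_left[symmetric])
    also have "norm \<dots> \<le> norm (F' 0 - D v) * norm q" by (rule norm_blinfun_compose)
    also have "\<dots> \<le> \<epsilon> * norm q"
      using near[OF dom] that
      by (intro mult_right_mono) (auto simp: U_def D_def Z_def norm_minus_commute)
    finally show ?thesis using \<epsilon>q by simp
  qed
  then have "\<forall>v\<in>U. \<exists>J. J o\<^sub>L (D v o\<^sub>L q) = id_blinfun \<and> (D v o\<^sub>L q) o\<^sub>L J = id_blinfun \<and> norm J \<le> 2"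
    using near_identity_invertible by blast
  then obtain J where J: "\<And>v. v \<in> U \<Longrightarrow> J v o\<^sub>L (D v o\<^sub>L q) = id_blinfun"
      "\<And>v. v \<in> U \<Longrightarrow> (D v o\<^sub>L q) o\<^sub>L J v = id_blinfun"
      "\<And>v. v \<in> U \<Longrightarrow> norm (J v) \<le> 2"
    by metis
  define \<delta>' where "\<delta>' v = J v o\<^sub>L D v" for v
  define E where "E v = id_blinfun - (q o\<^sub>L \<delta>' v)" for v
  \<comment> \<open>Formally \<open>\<delta>'' v h = J v \<circ> F'' (Z v) (E v h) \<circ> E v\<close>; writing it as a composition of bounded
    operators makes its continuity in \<open>v\<close> a matter of continuity of the factors.\<close>
  define \<delta>'' where "\<delta>'' v = compose.prod_right (J v) o\<^sub>L
    (compose.prod_left (E v) o\<^sub>L (F'' (Z v) o\<^sub>L E v))" for v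
  have d1: "(\<delta> has_derivative \<delta>' v) (at v within U)" if "v \<in> U" for v
    unfolding \<delta>'_def
  proof (rule implicit_solution_has_derivative)
    show "(F has_derivative D v) (at (v - q (\<delta> v)))" unfolding D_def Z_def by (rule F')
    show "J v o\<^sub>L D v o\<^sub>L q = id_blinfun"
      using J(1)[OF that] by (metis blinfun_compose_assoc)
  qed (use that Lip level in \<open>auto simp: U_def\<close>)
  have dZ: "(Z has_derivative E v) (at v within U)" if "v \<in> U" for v
    unfolding Z_def using d1[OF that]
    by (auto intro!: derivative_eq_intros simp: E_def blinfun.diff_left)
  have dD: "(D has_derivative (\<lambda>h. F'' (Z v) (E v h))) (at v within U)" if "v \<in> U" for v
    unfolding D_def by (rule has_derivative_compose[OF dZ[OF that] F''])
  have contZ: "continuous_on U Z" by (rule has_derivative_continuous_on[OF dZ])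
  have contD: "continuous_on U D" by (rule has_derivative_continuous_on[OF dD])
  have contJ: "continuous_on U J"
  proof (rule inverse_family_continuous[OF _ J])
    show "continuous_on U (\<lambda>v. D v o\<^sub>L q)"
      by (intro compose.continuous_on contD
          continuous_on_const)
  qed
  have \<delta>''_apply: "\<delta>'' v h = J v o\<^sub>L (F'' (Z v) (E v h) o\<^sub>L E v)" for v h
    by (simp add: \<delta>''_def)
  have d2: "(\<delta>' has_derivative \<delta>'' v) (at v within U)" if "v \<in> U" for v
    using implicit_derivative_has_derivative[OF dD[OF that] that contJ J(1,2)]
    unfolding \<delta>'_def[abs_def, symmetric] E_def[unfolded \<delta>'_def, symmetric]
    by (rule has_derivative_eq_rhs) (auto simp: fun_eq_iff \<delta>''_apply)
  have cont\<delta>': "continuous_on U \<delta>'"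
    by (rule has_derivative_continuous_on[OF d2])
  have contE: "continuous_on U E"
    unfolding E_def
    by (intro continuous_on_diff compose.continuous_on
        continuous_on_const cont\<delta>')
  have "continuous_on U \<delta>''"
    unfolding \<delta>''_def
    by (intro compose.continuous_on
        bounded_linear.continuous_on[OF compose.bounded_linear_prod_right]
        bounded_linear.continuous_on[OF compose.bounded_linear_prod_left]
        contJ contE continuous_on_compose2[OF cont contZ]) auto
  then have "C2_map_on U \<delta>"
    unfolding C2_map_on_def using d1 d2 by (intro exI[of _ \<delta>'] exI[of _ \<delta>'']) simp
  then show ?thesis
    using r level unfolding U_def q by (intro exI[of _ r] exI[of _ \<delta>] conjI ballI)
qed

section \<open>Correcting a retraction back into the constraint set\<close>

lemma tangent_space_mono:
  "M \<subseteq> N \<Longrightarrow> tangent_space M x \<subseteq> tangent_space N x"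
  unfolding tangent_space_def by blast

theorem lemma3p1:
  fixes M :: "'e::{real_inner, complete_space} set"
    and B :: "'e \<Rightarrow> 'y::{real_inner, complete_space}"
    and c :: 'y
    and P R :: "'e \<Rightarrow> 'e \<Rightarrow> 'e"
  assumes "C2_embedded_submanifold M"
    and "bounded_linear B" and "surj B"
    and "constraint_set M B c \<noteq> {}"
    and "\<And>x. x \<in> M \<Longrightarrow> bounded_projection_onto (P x) (tangent_space M x)"
    and "\<And>x. x \<in> constraint_set M B c \<Longrightarrow> invertible_operator (B \<circ> P x \<circ> adjoint B)"
    and "\<And>x. x \<in> M \<Longrightarrow> C2_retraction_at M x (R x)"
  shows "\<forall>x \<in> constraint_set M B c. \<exists>r > 0. \<exists>\<delta> :: 'e \<Rightarrow> 'y.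
           C2_map_on (tangent_ball (constraint_set M B c) x r) \<delta> \<and>
           (\<forall>v \<in> tangent_ball (constraint_set M B c) x r.
              R x (v - P x (adjoint B (\<delta> v))) \<in> constraint_set M B c)"
proof
  fix x
  assume x: "x \<in> constraint_set M B c"
  then have xM: "x \<in> M" and Bx: "B x = c" by (auto simp: constraint_set_def)
  let ?T = "tangent_space M x"
  have P: "bounded_linear (P x)" and range: "range (P x) = ?T" and PP: "\<And>v. P x (P x v) = P x v"
    using assms(5)[OF xM] by (auto simp: bounded_projection_onto_def)
  interpret P: bounded_linear "P x" by (rule P)
  have P_id: "P x v = v" if "v \<in> ?T" for v
    using that PP unfolding range[symmetric] by auto
  have R: "C2_map_on ?T (R x)" "R x ` ?T \<subseteq> M" "R x 0 = x"
      "(R x has_derivative (\<lambda>v. v)) (at 0 within ?T)"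
    using assms(7)[OF xM] by (auto simp: C2_retraction_at_def)
  obtain G where G: "bounded_linear G" and GL: "G \<circ> (B \<circ> P x \<circ> adjoint B) = id"
    and LG: "(B \<circ> P x \<circ> adjoint B) \<circ> G = id"
    using assms(6)[OF x] by (auto simp: invertible_operator_def)
  have GB: "bounded_linear (\<lambda>v. G (B v))"
    by (rule bounded_linear_compose[OF G assms(2)])
  define Q where "Q w = P x (adjoint B w)" for w
  have Q: "bounded_linear Q"
    unfolding Q_def by (rule bounded_linear_compose[OF P adjoint_bounded_linear[OF assms(2)]])
  define F where "F v = G (B (R x (P x v)))" for v
  have F: "C2_map_on UNIV F"
    unfolding F_def by (rule C2_map_on_compose_linear[OF R(1) GB P]) (simp add: range)
  have "((\<lambda>v. R x (P x v)) has_derivative P x) (at 0)"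
  \<comment> \<open>The derivative of the retraction is known only within \<open>T\<close>, which is the range of \<open>P x\<close>.\<close>
  proof (rule has_derivative_in_compose[where f = "P x" and g = "R x" and g' = "\<lambda>v. v"])
    show "(P x has_derivative P x) (at 0)" by (rule bounded_linear_imp_has_derivative[OF P])
    show "(R x has_derivative (\<lambda>v. v)) (at (P x 0) within range (P x))"
      using R(4) by (simp add: range P.zero)
  qed
  then have F0: "(F has_derivative (\<lambda>v. G (B (P x v)))) (at 0)"
    unfolding F_def by (rule bounded_linear.has_derivative[OF GB])
  have "G (B (P x (Q w))) = w" for w
    using GL by (simp add: Q_def PP fun_eq_iff)
  then obtain r \<delta> where r: "0 < r" and \<delta>: "C2_map_on (ball 0 r) \<delta>"
    and level: "\<And>v. v \<in> ball 0 r \<Longrightarrow> F (v - Q (\<delta> v)) = F 0"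
    using C2_solution_along_complement[OF F F0 Q] by blast
  have inj: "u = w" if "G u = G w" for u w
    using that LG by (metis comp_apply id_apply)
  let ?V = "tangent_ball (constraint_set M B c) x r"
  have V: "v \<in> ?T" "v \<in> ball 0 r" if "v \<in> ?V" for v
    using that tangent_space_mono[of "constraint_set M B c" M x]
    by (auto simp: tangent_ball_def constraint_set_def)
  have "R x (v - P x (adjoint B (\<delta> v))) \<in> constraint_set M B c" if v: "v \<in> ?V" for v
  proof -
    define z where "z = v - Q (\<delta> v)"
    have z: "P x z = z"
      by (simp add: z_def Q_def P.diff PP P_id V(1)[OF v])
    then have "z \<in> ?T" by (metis range rangeI)
    moreover have "B (R x z) = c"
    proof (rule inj)
      have "F z = F 0" unfolding z_def by (rule level[OF V(2)[OF v]])
      then show "G (B (R x z)) = G c" by (simp add: F_def z P.zero R(3) Bx)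
    qed
    ultimately show ?thesis
      using R(2) by (auto simp: constraint_set_def z_def Q_def)
  qed
  moreover have "C2_map_on ?V \<delta>"
    using V(2) by (intro C2_map_on_subset[OF \<delta>]) blast
  ultimately show "\<exists>r>0. \<exists>\<delta>. C2_map_on (tangent_ball (constraint_set M B c) x r) \<delta> \<and>
      (\<forall>v\<in>tangent_ball (constraint_set M B c) x r.
         R x (v - P x (adjoint B (\<delta> v))) \<in> constraint_set M B c)"
    using r by (intro exI[of _ r] exI[of _ \<delta>] conjI ballI)
qed

end
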